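(* Any proof labeling scheme for $\textsc{Permutation-Recognition}$, and any proof labeling scheme for $\textsc{Trapezoid-Recognition}$, must use certificates of size $\Omega(\log n)$ bits on $n$-node networks.
   Context: A permutation graph is a graph $G=([n],E)$, $[n]=\{0,\dots,n-1\}$ (up to isomorphism), for which there is a permutation $\pi$ of $[n]$ with $\{i,j\}\in E$ iff $(i-j)(\pi(i)-\pi(j))<0$. A trapezoid graph is the intersection graph of trapezoids each having one side on a fixed top horizontal line and one side on a fixed parallel bottom line. $\textsc{Permutation-Recognition}$ (resp. $\textsc{Trapezoid-Recognition}$) is the set of configurations $\langle G,\mathrm{id}\rangle$ with $G$ a permutation (resp. trapezoid) graph. Distributed setting: $G$ is a simple connected $n$-node graph, nodes have unique identifiers in $\{1,\dots,\mathrm{poly}(n)\}$. A proof labeling scheme: an untrusted prover assigns each node a certificate; in one deterministic round each node sees its own id and certificate and those of its neighbors, and accepts or rejects; on yes-instances some assignment makes all nodes accept, on no-instances every assignment makes some node reject. Its size is the maximum certificate length. *)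

theory Defs
  imports "HOL-Analysis.Analysis" "HOL-Library.Landau_Symbols"
begin

definition simple_graph :: "nat \<Rightarrow> (nat \<Rightarrow> nat \<Rightarrow> bool) \<Rightarrow> bool" where
  "simple_graph n E \<longleftrightarrow>
     (\<forall>u v. E u v \<longrightarrow> u < n \<and> v < n) \<and> (\<forall>u v. E u v \<longrightarrow> E v u) \<and> (\<forall>u. \<not> E u u)"

definition connected_graph :: "nat \<Rightarrow> (nat \<Rightarrow> nat \<Rightarrow> bool) \<Rightarrow> bool" where
  "connected_graph n E \<longleftrightarrow> (\<forall>u<n. \<forall>v<n. E\<^sup>*\<^sup>* u v)"

definition permutation_graph :: "nat \<Rightarrow> (nat \<Rightarrow> nat \<Rightarrow> bool) \<Rightarrow> bool" where
  "permutation_graph n E \<longleftrightarrow>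
     (\<exists>f pi. bij_betw f {0..<n} {0..<n} \<and> pi permutes {0..<n} \<and>
        (\<forall>u<n. \<forall>v<n. E u v \<longleftrightarrow>
            (int (f u) - int (f v)) * (int (pi (f u)) - int (pi (f v))) < 0))"

definition trapezoid :: "real \<Rightarrow> real \<Rightarrow> real \<Rightarrow> real \<Rightarrow> (real \<times> real) set" where
  "trapezoid a b c d = convex hull {(a, 1), (b, 1), (c, 0), (d, 0)}"

definition trapezoid_graph :: "nat \<Rightarrow> (nat \<Rightarrow> nat \<Rightarrow> bool) \<Rightarrow> bool" where
  "trapezoid_graph n E \<longleftrightarrow>
     (\<exists>a b c d :: nat \<Rightarrow> real.
        (\<forall>u<n. a u \<le> b u \<and> c u \<le> d u) \<and>
        (\<forall>u<n. \<forall>v<n. E u v \<longleftrightarrow>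
            u \<noteq> v \<and> trapezoid (a u) (b u) (c u) (d u) \<inter> trapezoid (a v) (b v) (c v) (d v) \<noteq> {}))"

definition legal_config :: "nat \<Rightarrow> nat \<Rightarrow> (nat \<Rightarrow> nat \<Rightarrow> bool) \<Rightarrow> (nat \<Rightarrow> nat) \<Rightarrow> bool" where
  "legal_config k n E ident \<longleftrightarrow>
     n \<ge> 1 \<and> simple_graph n E \<and> connected_graph n E \<and>
     inj_on ident {0..<n} \<and> (\<forall>u<n. ident u \<in> {1..n ^ k})"

definition local_view ::
  "nat \<Rightarrow> (nat \<Rightarrow> nat \<Rightarrow> bool) \<Rightarrow> (nat \<Rightarrow> nat) \<Rightarrow> (nat \<Rightarrow> bool list) \<Rightarrow> nat
     \<Rightarrow> nat \<times> bool list \<times> (nat \<times> bool list) set" where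
  "local_view n E ident cert u = (ident u, cert u, {(ident v, cert v) | v. v < n \<and> E u v})"

definition is_pls ::
  "(nat \<Rightarrow> (nat \<Rightarrow> nat \<Rightarrow> bool) \<Rightarrow> bool) \<Rightarrow> nat
    \<Rightarrow> (nat \<times> bool list \<times> (nat \<times> bool list) set \<Rightarrow> bool) \<Rightarrow> (nat \<Rightarrow> nat) \<Rightarrow> bool" where
  "is_pls P k Ver s \<longleftrightarrow>
     (\<forall>n E ident. legal_config k n E ident \<and> P n E \<longrightarrow>
        (\<exists>cert. (\<forall>u<n. length (cert u) \<le> s n) \<and>
               (\<forall>u<n. Ver (local_view n E ident cert u)))) \<and>
     (\<forall>n E ident cert. legal_config k n E ident \<and> \<not> P n E \<longrightarrow>
        (\<exists>u<n. \<not> Ver (local_view n E ident cert u)))"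

end

theory Submission
  imports Defs "HOL-Combinatorics.Permutations"
begin

text \<open>For permutations \<open>\<sigma>\<close>, \<open>\<tau>\<close> of \<open>{..<m}\<close>, take \<open>m\<close> copies of the square Hub, Port, Dock, Rim
  with the tail Stem, Leaf attached to Hub, rewire \<open>Hub\<^sub>i\<close> to the port of copy \<open>\<sigma> i\<close> and \<open>Rim\<^sub>i\<close>
  to the dock of copy \<open>\<tau> i\<close>, and add universal vertices. If \<open>\<sigma> = \<tau>\<close>, this merely relabels the
  copies, and the result is a permutation graph. If \<open>\<sigma> i \<noteq> \<tau> i\<close>, then \<open>Leaf\<^sub>i\<close> and the docks
  \<open>\<sigma> i\<close> and \<open>\<tau> i\<close> are the ends of a subdivided claw around \<open>Hub\<^sub>i\<close>, an asteroidal triple, which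
  no trapezoid graph has. Every vertex sees at most one of \<open>\<sigma>\<close> and \<open>\<tau>\<close>, so if the instances
  \<open>(\<sigma>, \<sigma>)\<close> and \<open>(\<tau>, \<tau>)\<close> were accepted with the same certificates, then the mixed instance
  \<open>(\<sigma>, \<tau>)\<close> would be accepted as well. Hence the \<open>m!\<close> permutations need distinct certificate
  assignments, and there are only \<open>2\<close> to the \<open>O(n s)\<close> of them, where \<open>n\<close> is about \<open>6 m\<close>.\<close>

section \<open>Permutation graphs as crossing segments\<close>

definition segments_cross :: "('a \<Rightarrow> 'b::order) \<Rightarrow> ('a \<Rightarrow> 'b) \<Rightarrow> 'a \<Rightarrow> 'a \<Rightarrow> bool" where
  "segments_cross x y u v \<longleftrightarrow> x u < x v \<and> y v < y u \<or> x v < x u \<and> y u < y v"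

lemma ex_bij_betw_order_preserving:
  fixes x :: "'a \<Rightarrow> 'b::wellorder"
  assumes "finite V" "inj_on x V"
  obtains r where "bij_betw r V {0..<card V}"
    and "\<And>u v. u \<in> V \<Longrightarrow> v \<in> V \<Longrightarrow> r u < r v \<longleftrightarrow> x u < x v"
proof -
  obtain h where h: "bij_betw h {..<card V} (x ` V)" and mono: "strict_mono_on {..<card V} h"
    using ex_bij_betw_strict_mono_card[of "x ` V"] assms by (auto simp: card_image)
  define r where "r = inv_into {..<card V} h \<circ> x"
  have bij: "bij_betw r V {0..<card V}"
    using bij_betw_trans[OF inj_on_imp_bij_betw[OF assms(2)] bij_betw_inv_into[OF h]]
    by (simp add: r_def lessThan_atLeast0)
  have h_r: "h (r u) = x u" if "u \<in> V" for u
    using that bij_betw_inv_into_right[OF h] by (simp add: r_def)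
  have "r u < r v \<longleftrightarrow> x u < x v" if "u \<in> V" "v \<in> V" for u v
    using that bij_betwE[OF bij] strict_mono_on_less[OF mono, of "r u" "r v"]
    by (simp add: h_r)
  with bij show ?thesis by (rule that)
qed

lemma permutation_graphI:
  fixes x y :: "nat \<Rightarrow> 'a::wellorder"
  assumes "inj_on x {0..<n}" "inj_on y {0..<n}"
    and E: "\<And>u v. u < n \<Longrightarrow> v < n \<Longrightarrow> E u v \<longleftrightarrow> segments_cross x y u v"
  shows "permutation_graph n E"
proof -
  obtain f where f: "bij_betw f {0..<n} {0..<n}"
    and f_less: "\<And>u v. u < n \<Longrightarrow> v < n \<Longrightarrow> f u < f v \<longleftrightarrow> x u < x v"
    using ex_bij_betw_order_preserving[OF _ assms(1)] by auto
  obtain g where g: "bij_betw g {0..<n} {0..<n}"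
    and g_less: "\<And>u v. u < n \<Longrightarrow> v < n \<Longrightarrow> g u < g v \<longleftrightarrow> y u < y v"
    using ex_bij_betw_order_preserving[OF _ assms(2)] by auto
  define p where "p i = (if i < n then g (inv_into {0..<n} f i) else i)" for i
  have "bij_betw (g \<circ> inv_into {0..<n} f) {0..<n} {0..<n}"
    using bij_betw_trans[OF bij_betw_inv_into[OF f] g] .
  then have "bij_betw p {0..<n} {0..<n}"
    by (rule iffD1[OF bij_betw_cong, rotated]) (auto simp: p_def)
  then have perm: "p permutes {0..<n}"
    by (rule bij_imp_permutes) (auto simp: p_def)
  have p_f: "p (f u) = g u" if "u < n" for u
    using that f bij_betwE[OF f] by (auto simp: p_def bij_betw_def)
  have "E u v \<longleftrightarrow> (int (f u) - int (f v)) * (int (p (f u)) - int (p (f v))) < 0"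
    if "u < n" "v < n" for u v
    using that E[OF that] f_less g_less
    by (auto simp: p_f mult_less_0_iff segments_cross_def)
  then show ?thesis
    unfolding permutation_graph_def using f perm by blast
qed

lemma permutation_graphE:
  assumes "permutation_graph n E"
  obtains x y :: "nat \<Rightarrow> nat" where "inj_on x {0..<n}" "inj_on y {0..<n}"
    and "\<And>u v. u < n \<Longrightarrow> v < n \<Longrightarrow> E u v \<longleftrightarrow> segments_cross x y u v"
proof -
  obtain f p where f: "bij_betw f {0..<n} {0..<n}" and p: "p permutes {0..<n}"
    and E: "\<And>u v. u < n \<Longrightarrow> v < n \<Longrightarrow> E u v \<longleftrightarrow>
      (int (f u) - int (f v)) * (int (p (f u)) - int (p (f v))) < 0"
    using assms unfolding permutation_graph_def by blast
  have "inj_on f {0..<n}" using f by (rule bij_betw_imp_inj_on)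
  moreover from this have "inj_on (p \<circ> f) {0..<n}"
    using permutes_inj_on[OF p] by (rule comp_inj_on)
  moreover have "E u v \<longleftrightarrow> segments_cross f (p \<circ> f) u v" if "u < n" "v < n" for u v
    using E[OF that] by (auto simp: segments_cross_def mult_less_0_iff)
  ultimately show ?thesis by (rule that)
qed

section \<open>Trapezoids\<close>

lemma trapezoid_Int_eq_empty_if_left:
  assumes "a \<le> b" "c \<le> d" "a' \<le> b'" "c' \<le> d'" "b < a'" "d < c'"
  shows "trapezoid a b c d \<inter> trapezoid a' b' c' d' = {}"
proof -
  \<comment> \<open>The line through \<open>(\<beta>, 1)\<close> and \<open>(\<gamma>, 0)\<close> separates the two trapezoids.\<close>
  define \<beta> where "\<beta> = (b + a') / 2"
  define \<gamma> where "\<gamma> = (d + c') / 2"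
  have bounds: "b < \<beta>" "\<beta> < a'" "d < \<gamma>" "\<gamma> < c'"
    using assms by (auto simp: \<beta>_def \<gamma>_def)
  have "trapezoid a b c d \<subseteq> {x. inner (1, \<gamma> - \<beta>) x < \<gamma>}"
    unfolding trapezoid_def using assms bounds
    by (intro hull_minimal convex_halfspace_lt) (auto simp: inner_prod_def)
  moreover have "trapezoid a' b' c' d' \<subseteq> {x. inner (1, \<gamma> - \<beta>) x > \<gamma>}"
    unfolding trapezoid_def using assms bounds
    by (intro hull_minimal convex_halfspace_gt) (auto simp: inner_prod_def)
  ultimately show ?thesis by fastforce
qed

lemma convex_horizontal_between:
  fixes S :: "(real \<times> 'a::real_vector) set"
  assumes "convex S" "(x, h) \<in> S" "(y, h) \<in> S" "x \<le> p" "p \<le> y"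
  shows "(p, h) \<in> S"
proof -
  have "p \<in> closed_segment x y"
    using assms by (simp add: closed_segment_eq_real_ivl)
  then obtain u where "0 \<le> u" "u \<le> 1" "p = (1 - u) * x + u * y"
    by (auto simp: in_segment)
  then show ?thesis
    using convexD_alt[OF assms(1-3), of u] by (simp flip: scaleR_left_distrib)
qed

lemma segment_in_trapezoid:
  assumes "a \<le> p" "p \<le> b" "c \<le> q" "q \<le> d" "0 \<le> t" "t \<le> 1"
  shows "(t * p + (1 - t) * q, t) \<in> trapezoid a b c d"
proof -
  have convex: "convex (trapezoid a b c d)" by (simp add: trapezoid_def)
  have "{(a, 1), (b, 1), (c, 0), (d, 0)} \<subseteq> trapezoid a b c d"
    unfolding trapezoid_def by (rule hull_subset)
  then have "(p, 1) \<in> trapezoid a b c d" "(q, 0) \<in> trapezoid a b c d"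
    using assms convex_horizontal_between[OF convex, of a 1 b p]
      convex_horizontal_between[OF convex, of c 0 d q] by simp_all
  then have "(1 - t) *\<^sub>R (q, 0) + t *\<^sub>R (p, 1) \<in> trapezoid a b c d"
    using convex assms by (intro convexD_alt) auto
  then show ?thesis by (simp add: algebra_simps)
qed

lemma trapezoid_Int_nonempty_if_cross:
  assumes "a \<le> b" "c \<le> d" "a' \<le> b'" "c' \<le> d'" "a' \<le> b" "c \<le> d'"
  shows "trapezoid a b c d \<inter> trapezoid a' b' c' d' \<noteq> {}"
proof -
  define D where "D = (b - a') + (d' - c)"
  define t where "t = (d' - c) / D"
  have t: "0 \<le> t" "t \<le> 1"
    using assms by (auto simp: t_def D_def divide_le_eq_1)
  have "t * D = d' - c"
    using assms by (cases "D = 0") (auto simp: t_def D_def)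
  then have "t * b + (1 - t) * c = t * a' + (1 - t) * d'"
    by (simp add: D_def algebra_simps)
  moreover have "(t * b + (1 - t) * c, t) \<in> trapezoid a b c d"
    using assms t by (intro segment_in_trapezoid) auto
  moreover have "(t * a' + (1 - t) * d', t) \<in> trapezoid a' b' c' d'"
    using assms t by (intro segment_in_trapezoid) auto
  ultimately show ?thesis by auto
qed

lemma trapezoid_Int_nonempty_iff:
  assumes "a \<le> b" "c \<le> d" "a' \<le> b'" "c' \<le> d'"
  shows "trapezoid a b c d \<inter> trapezoid a' b' c' d' \<noteq> {} \<longleftrightarrow>
         \<not> (b < a' \<and> d < c') \<and> \<not> (b' < a \<and> d' < c)" (is "?meet \<longleftrightarrow> ?cross")
proof
  assume ?meet
  then show ?cross
    using trapezoid_Int_eq_empty_if_left[of a b c d a' b' c' d']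
      trapezoid_Int_eq_empty_if_left[of a' b' c' d' a b c d] assms by blast
next
  assume ?cross
  then consider (top) "a' \<le> b" "a \<le> b'" | (bottom) "c' \<le> d" "c \<le> d'"
    | (falling) "a' \<le> b" "c \<le> d'" | (rising) "a \<le> b'" "c' \<le> d"
    by linarith
  then show ?meet
  proof cases
    case top
    have "(max a a', 1) \<in> trapezoid a b c d"
      using segment_in_trapezoid[of a "max a a'" b c c d 1] top assms by simp
    moreover have "(max a a', 1) \<in> trapezoid a' b' c' d'"
      using segment_in_trapezoid[of a' "max a a'" b' c' c' d' 1] top assms by simp
    ultimately show ?thesis by blast
  next
    case bottom
    have "(max c c', 0) \<in> trapezoid a b c d"
      using segment_in_trapezoid[of a a b c "max c c'" d 0] bottom assms by simp
    moreover have "(max c c', 0) \<in> trapezoid a' b' c' d'"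
      using segment_in_trapezoid[of a' a' b' c' "max c c'" d' 0] bottom assms by simp
    ultimately show ?thesis by blast
  next
    case falling
    then show ?thesis using trapezoid_Int_nonempty_if_cross assms by blast
  next
    case rising
    then show ?thesis
      using trapezoid_Int_nonempty_if_cross[of a' b' c' d' a b c d] assms by blast
  qed
qed

lemma permutation_graph_imp_trapezoid_graph:
  assumes "permutation_graph n E"
  shows "trapezoid_graph n E"
proof -
  obtain f g :: "nat \<Rightarrow> nat" where inj: "inj_on f {0..<n}" "inj_on g {0..<n}"
    and E: "\<And>u v. u < n \<Longrightarrow> v < n \<Longrightarrow> E u v \<longleftrightarrow> segments_cross f g u v"
    using permutation_graphE[OF assms] by blast
  define x where "x u = real (f u)" for u
  define y where "y u = real (g u)" for u
  have "E u v \<longleftrightarrow> u \<noteq> v \<and>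
      trapezoid (x u) (x u) (y u) (y u) \<inter> trapezoid (x v) (x v) (y v) (y v) \<noteq> {}"
    if "u < n" "v < n" for u v
  proof -
    have "f u \<noteq> f v \<and> g u \<noteq> g v" if "u \<noteq> v"
      using that inj \<open>u < n\<close> \<open>v < n\<close> by (auto dest: inj_onD)
    then show ?thesis
      using E[OF that]
      by (subst trapezoid_Int_nonempty_iff) (auto simp: x_def y_def segments_cross_def)
  qed
  then show ?thesis
    unfolding trapezoid_graph_def by (intro exI[of _ x] exI[of _ y]) auto
qed

section \<open>Cocomparability graphs and asteroidal triples\<close>

definition cocomparability_graph :: "'a set \<Rightarrow> ('a \<Rightarrow> 'a \<Rightarrow> bool) \<Rightarrow> bool" where
  "cocomparability_graph V E \<longleftrightarrow>
     (\<exists>L. irreflp_on V L \<and> transp_on V L \<and>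
        (\<forall>u\<in>V. \<forall>v\<in>V. u \<noteq> v \<longrightarrow> (E u v \<longleftrightarrow> \<not> L u v \<and> \<not> L v u)))"

definition edge_avoiding :: "'a set \<Rightarrow> ('a \<Rightarrow> 'a \<Rightarrow> bool) \<Rightarrow> 'a \<Rightarrow> 'a \<Rightarrow> 'a \<Rightarrow> bool" where
  "edge_avoiding V E z u v \<longleftrightarrow>
     u \<in> V \<and> v \<in> V \<and> E u v \<and> u \<noteq> v \<and> u \<noteq> z \<and> v \<noteq> z \<and> \<not> E z u \<and> \<not> E z v"

text \<open>Independence of the triple need not be required: the paths are nontrivial, so their endpoints
  avoid the neighbourhood of the third vertex.\<close>

definition asteroidal_triple :: "'a set \<Rightarrow> ('a \<Rightarrow> 'a \<Rightarrow> bool) \<Rightarrow> 'a \<Rightarrow> 'a \<Rightarrow> 'a \<Rightarrow> bool" where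
  "asteroidal_triple V E x y z \<longleftrightarrow>
     {x, y, z} \<subseteq> V \<and> distinct [x, y, z] \<and>
     (edge_avoiding V E x)\<^sup>*\<^sup>* y z \<and> (edge_avoiding V E y)\<^sup>*\<^sup>* z x \<and> (edge_avoiding V E z)\<^sup>*\<^sup>* x y"

lemma trapezoid_graph_imp_cocomparability_graph:
  assumes "trapezoid_graph n E"
  shows "cocomparability_graph {..<n} E"
proof -
  obtain a b c d :: "nat \<Rightarrow> real"
    where ordered: "\<forall>u<n. a u \<le> b u \<and> c u \<le> d u"
    and E: "\<forall>u<n. \<forall>v<n. E u v \<longleftrightarrow> u \<noteq> v \<and>
      trapezoid (a u) (b u) (c u) (d u) \<inter> trapezoid (a v) (b v) (c v) (d v) \<noteq> {}"
    using assms unfolding trapezoid_graph_def by (elim exE conjE)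
  define L where "L u v \<longleftrightarrow> b u < a v \<and> d u < c v" for u v
  have "irreflp_on {..<n} L"
    using ordered by (intro irreflp_onI) (force simp: L_def)
  moreover have "transp_on {..<n} L"
    using ordered by (intro transp_onI) (force simp: L_def)
  moreover have "E u v \<longleftrightarrow> \<not> L u v \<and> \<not> L v u" if "u < n" "v < n" "u \<noteq> v" for u v
    using that ordered E by (simp add: trapezoid_Int_nonempty_iff L_def)
  ultimately show ?thesis
    unfolding cocomparability_graph_def by (intro exI[of _ L]) auto
qed

lemma cocomparability_graph_subset:
  assumes "cocomparability_graph V E" "W \<subseteq> V"
    and "\<And>u v. u \<in> W \<Longrightarrow> v \<in> W \<Longrightarrow> u \<noteq> v \<Longrightarrow> F u v \<longleftrightarrow> E u v"
  shows "cocomparability_graph W F"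
proof -
  obtain L where "irreflp_on V L" "transp_on V L"
    and "\<forall>u\<in>V. \<forall>v\<in>V. u \<noteq> v \<longrightarrow> (E u v \<longleftrightarrow> \<not> L u v \<and> \<not> L v u)"
    using assms(1) unfolding cocomparability_graph_def by blast
  then show ?thesis
    unfolding cocomparability_graph_def using assms(2,3)
    by (intro exI[of _ L]) (auto intro: irreflp_on_subset transp_on_subset)
qed

lemma cocomparability_graph_image:
  assumes "cocomparability_graph V (\<lambda>u v. E (f u) (f v))" "inj_on f V"
  shows "cocomparability_graph (f ` V) E"
proof -
  obtain L where irrefl: "irreflp_on V L" and trans: "transp_on V L"
    and E: "\<And>u v. u \<in> V \<Longrightarrow> v \<in> V \<Longrightarrow> u \<noteq> v \<Longrightarrow> E (f u) (f v) \<longleftrightarrow> \<not> L u v \<and> \<not> L v u"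
    using assms(1) unfolding cocomparability_graph_def by blast
  define M where "M p q \<longleftrightarrow> L (inv_into V f p) (inv_into V f q)" for p q
  have "irreflp_on (f ` V) M"
    using irrefl assms(2) by (auto simp: irreflp_on_def M_def)
  moreover have "transp_on (f ` V) M"
    unfolding M_def by (intro transp_onI) (meson inv_into_into transp_onD trans)
  moreover have "E p q \<longleftrightarrow> \<not> M p q \<and> \<not> M q p"
    if pq: "p \<in> f ` V" "q \<in> f ` V" "p \<noteq> q" for p q
  proof -
    obtain u v where "u \<in> V" "v \<in> V" "p = f u" "q = f v" using pq by blast
    then show ?thesis using E[of u v] pq(3) assms(2) by (cases "u = v") (auto simp: M_def)
  qed
  ultimately show ?thesis
    unfolding cocomparability_graph_def by blast
qed

lemma not_adjacent_if_path_avoiding: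
  assumes "(edge_avoiding V E z)\<^sup>*\<^sup>* u v" "u \<noteq> v"
  shows "\<not> E z u"
  using assms by (auto simp: edge_avoiding_def elim: converse_rtranclpE)

lemma same_side_if_path_avoiding:
  assumes trans: "transp_on V L" and "z \<in> V"
    and E: "\<forall>u\<in>V. \<forall>v\<in>V. u \<noteq> v \<longrightarrow> (E u v \<longleftrightarrow> \<not> L u v \<and> \<not> L v u)"
    and path: "(edge_avoiding V E z)\<^sup>*\<^sup>* u v"
  shows "L z u \<longleftrightarrow> L z v"
  using path
proof (induction rule: rtranclp_induct)
  case (step v w)
  then have "v \<in> V" "w \<in> V" "\<not> L v w" "\<not> L w v" "L z v \<or> L v z" "L z w \<or> L w z"
    using E \<open>z \<in> V\<close> unfolding edge_avoiding_def by metis+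
  then have "L z v \<longleftrightarrow> L z w"
    using transp_onD[OF trans] \<open>z \<in> V\<close> by blast
  with step.IH show ?case by simp
qed simp

lemma cocomparability_graph_imp_no_asteroidal_triple:
  assumes "cocomparability_graph V E"
  shows "\<not> asteroidal_triple V E x y z"
proof
  assume "asteroidal_triple V E x y z"
  then have V: "x \<in> V" "y \<in> V" "z \<in> V" and distinct: "x \<noteq> y" "y \<noteq> z" "z \<noteq> x"
    and paths: "(edge_avoiding V E x)\<^sup>*\<^sup>* y z" "(edge_avoiding V E y)\<^sup>*\<^sup>* z x"
      "(edge_avoiding V E z)\<^sup>*\<^sup>* x y"
    by (auto simp: asteroidal_triple_def)
  obtain L where irrefl: "irreflp_on V L" and trans: "transp_on V L"
    and E: "\<forall>u\<in>V. \<forall>v\<in>V. u \<noteq> v \<longrightarrow> (E u v \<longleftrightarrow> \<not> L u v \<and> \<not> L v u)"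
    using assms unfolding cocomparability_graph_def by blast
  have asym: "L u v \<Longrightarrow> \<not> L v u" if "u \<in> V" "v \<in> V" for u v
    using that irreflp_onD[OF irrefl that(1)] transp_onD[OF trans that(1,2,1)] by blast
  have "\<not> E x y" "\<not> E y z" "\<not> E z x"
    using paths distinct by (auto dest: not_adjacent_if_path_avoiding)
  then have "L x y \<noteq> L y x" "L y z \<noteq> L z y" "L z x \<noteq> L x z"
    using E V distinct asym by metis+
  moreover have "L x y \<longleftrightarrow> L x z" "L y z \<longleftrightarrow> L y x" "L z x \<longleftrightarrow> L z y"
    using paths V by (simp_all add: same_side_if_path_avoiding[OF trans _ E])
  ultimately show False by blast
qed

section \<open>Adding universal vertices\<close>

definition add_universal :: "nat \<Rightarrow> nat \<Rightarrow> (nat \<Rightarrow> nat \<Rightarrow> bool) \<Rightarrow> nat \<Rightarrow> nat \<Rightarrow> bool" where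
  "add_universal N n E u v \<longleftrightarrow> u < n \<and> v < n \<and> u \<noteq> v \<and> (N \<le> u \<or> N \<le> v \<or> E u v)"

lemma legal_config_add_universal:
  assumes "k \<ge> 1" "N < n" "symp E"
  shows "legal_config k n (add_universal N n E) Suc"
proof -
  have "simple_graph n (add_universal N n E)"
    using sympD[OF \<open>symp E\<close>] by (auto simp: simple_graph_def add_universal_def)
  moreover have "(add_universal N n E)\<^sup>*\<^sup>* u N \<and> (add_universal N n E)\<^sup>*\<^sup>* N u" if "u < n" for u
    using that \<open>N < n\<close> by (cases "u = N") (auto simp: add_universal_def)
  then have "connected_graph n (add_universal N n E)"
    unfolding connected_graph_def by (meson rtranclp_trans)
  moreover have "Suc u \<le> n ^ k" if "u < n" for u
    using that self_le_power[of n k] \<open>k \<ge> 1\<close> by linarith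
  ultimately show ?thesis
    using \<open>N < n\<close> by (auto simp: legal_config_def)
qed

lemma permutation_graph_add_universal:
  assumes "permutation_graph N E"
  shows "permutation_graph n (add_universal N n E)"
proof -
  obtain x y :: "nat \<Rightarrow> nat" where inj: "inj_on x {0..<N}" "inj_on y {0..<N}"
    and E: "\<And>u v. u < N \<Longrightarrow> v < N \<Longrightarrow> E u v \<longleftrightarrow> segments_cross x y u v"
    using permutation_graphE[OF assms] by blast
  define B where "B = Suc (Max (y ` {0..<N}))"
  have B: "y u < B" if "u < N" for u
    using that by (simp add: B_def less_Suc_eq_le)
  \<comment> \<open>The new segments start left of all old ones, end right of them, and cross each other.\<close>
  define x' where "x' u = (if u < N then n + x u else n - u)" for u
  define y' where "y' u = (if u < N then y u else B + u)" for u
  show ?thesis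
  proof (rule permutation_graphI)
    show "inj_on x' {0..<n}"
      by (rule inj_onI) (auto simp: x'_def inj_on_eq_iff[OF inj(1)] split: if_splits)
    show "inj_on y' {0..<n}"
      using B by (intro inj_onI) (force simp: y'_def inj_on_eq_iff[OF inj(2)] split: if_splits)
    fix u v assume "u < n" "v < n"
    then show "add_universal N n E u v \<longleftrightarrow> segments_cross x' y' u v"
      using E[of u v] B[of u] B[of v]
      by (cases "u < N"; cases "v < N") (auto simp: add_universal_def segments_cross_def x'_def y'_def)
  qed
qed

section \<open>The gadget graphs\<close>

datatype role = Hub | Rim | Port | Dock | Stem | Leaf

fun arc :: "(nat \<Rightarrow> nat) \<Rightarrow> (nat \<Rightarrow> nat) \<Rightarrow> role \<times> nat \<Rightarrow> role \<times> nat \<Rightarrow> bool" where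
  "arc \<sigma> \<tau> (c, i) (d, j) \<longleftrightarrow>
     (c, d) \<in> {(Rim, Hub), (Port, Dock), (Hub, Stem), (Stem, Leaf)} \<and> j = i \<or>
     (c, d) = (Hub, Port) \<and> j = \<sigma> i \<or> (c, d) = (Rim, Dock) \<and> j = \<tau> i"

definition linked :: "(nat \<Rightarrow> nat) \<Rightarrow> (nat \<Rightarrow> nat) \<Rightarrow> role \<times> nat \<Rightarrow> role \<times> nat \<Rightarrow> bool" where
  "linked \<sigma> \<tau> p q \<longleftrightarrow> arc \<sigma> \<tau> p q \<or> arc \<sigma> \<tau> q p"

lemma symp_linked: "symp (linked \<sigma> \<tau>)"
  by (auto simp: symp_def linked_def)

lemma linked_eq_diagonal_left:
  assumes "fst p \<notin> {Rim, Dock}"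
  shows "linked \<sigma> \<tau> p q \<longleftrightarrow> linked \<sigma> \<sigma> p q"
  using assms by (cases p; cases q) (auto simp: linked_def)

lemma linked_eq_diagonal_right:
  assumes "fst p \<in> {Rim, Dock}"
  shows "linked \<sigma> \<tau> p q \<longleftrightarrow> linked \<tau> \<tau> p q"
  using assms by (cases p; cases q) (auto simp: linked_def)

fun component :: "(nat \<Rightarrow> nat) \<Rightarrow> role \<times> nat \<Rightarrow> nat" where
  "component \<sigma> (c, i) = (if c \<in> {Port, Dock} then i else \<sigma> i)"

primrec top_rank :: "role \<Rightarrow> nat" where
  "top_rank Dock = 0" | "top_rank Hub = 1" | "top_rank Rim = 2"
| "top_rank Port = 3" | "top_rank Leaf = 4" | "top_rank Stem = 5"

primrec bottom_rank :: "role \<Rightarrow> nat" where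
  "bottom_rank Rim = 0" | "bottom_rank Port = 1" | "bottom_rank Dock = 2"
| "bottom_rank Stem = 3" | "bottom_rank Hub = 4" | "bottom_rank Leaf = 5"

definition stacked :: "(nat \<Rightarrow> nat) \<Rightarrow> (role \<Rightarrow> nat) \<Rightarrow> role \<times> nat \<Rightarrow> nat" where
  "stacked \<sigma> r p = 6 * component \<sigma> p + r (fst p)"

lemma top_bottom_rank_less_6: "top_rank c < 6" "bottom_rank c < 6"
  by (cases c; simp)+

lemma inj_top_bottom_rank: "inj top_rank" "inj bottom_rank"
proof -
  have "top_rank c = top_rank d \<Longrightarrow> c = d" "bottom_rank c = bottom_rank d \<Longrightarrow> c = d" for c d
    by (cases c; cases d; simp)+
  then show "inj top_rank" "inj bottom_rank" by (auto intro: injI)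
qed

lemma inj_stacked:
  assumes "inj \<sigma>" "inj r" "\<And>c. r c < 6"
  shows "inj (stacked \<sigma> r)"
proof (rule injI)
  fix p q assume eq: "stacked \<sigma> r p = stacked \<sigma> r q"
  have "stacked \<sigma> r p div 6 = component \<sigma> p" "stacked \<sigma> r p mod 6 = r (fst p)" for p
    using assms(3)[of "fst p"] by (simp_all add: stacked_def)
  with eq have "component \<sigma> p = component \<sigma> q" "r (fst p) = r (fst q)"
    by metis+
  then show "p = q"
    using assms(1,2) by (cases p; cases q) (auto dest: injD split: if_splits)
qed

lemma linked_diagonal_iff_segments_cross:
  assumes "inj \<sigma>"
  shows "linked \<sigma> \<sigma> p q \<longleftrightarrow>
    segments_cross (stacked \<sigma> top_rank) (stacked \<sigma> bottom_rank) p q"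
proof (cases "component \<sigma> p = component \<sigma> q")
  case True
  obtain c i d j where [simp]: "p = (c, i)" "q = (d, j)" by (cases p; cases q)
  show ?thesis
    using True injD[OF assms, of i j]
    by (cases c; cases d) (auto simp: linked_def segments_cross_def stacked_def)
next
  case False
  then have "\<not> linked \<sigma> \<sigma> p q"
    by (cases p; cases q) (auto simp: linked_def)
  moreover have "\<not> segments_cross (stacked \<sigma> top_rank) (stacked \<sigma> bottom_rank) p q"
    using False top_bottom_rank_less_6[of "fst p"] top_bottom_rank_less_6[of "fst q"]
    by (auto simp: segments_cross_def stacked_def)
  ultimately show ?thesis by simp
qed

lemma asteroidal_triple_linked:
  assumes "i < m" "\<sigma> i < m" "\<tau> i < m" "\<sigma> i \<noteq> \<tau> i"
  shows "asteroidal_triple (UNIV \<times> {..<m}) (linked \<sigma> \<tau>) (Leaf, i) (Dock, \<sigma> i) (Dock, \<tau> i)"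
proof -
  let ?edge = "edge_avoiding (UNIV \<times> {..<m}) (linked \<sigma> \<tau>)"
  note [simp] = edge_avoiding_def linked_def
  have "?edge (Leaf, i) (Dock, \<sigma> i) (Port, \<sigma> i)" "?edge (Leaf, i) (Port, \<sigma> i) (Hub, i)"
    "?edge (Leaf, i) (Hub, i) (Rim, i)" "?edge (Leaf, i) (Rim, i) (Dock, \<tau> i)"
    using assms by auto
  then have "(?edge (Leaf, i))\<^sup>*\<^sup>* (Dock, \<sigma> i) (Dock, \<tau> i)"
    by (blast intro: converse_rtranclp_into_rtranclp)
  moreover have "?edge (Dock, \<sigma> i) (Dock, \<tau> i) (Rim, i)" "?edge (Dock, \<sigma> i) (Rim, i) (Hub, i)"
    "?edge (Dock, \<sigma> i) (Hub, i) (Stem, i)" "?edge (Dock, \<sigma> i) (Stem, i) (Leaf, i)"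
    using assms by auto
  then have "(?edge (Dock, \<sigma> i))\<^sup>*\<^sup>* (Dock, \<tau> i) (Leaf, i)"
    by (blast intro: converse_rtranclp_into_rtranclp)
  moreover have "?edge (Dock, \<tau> i) (Leaf, i) (Stem, i)" "?edge (Dock, \<tau> i) (Stem, i) (Hub, i)"
    "?edge (Dock, \<tau> i) (Hub, i) (Port, \<sigma> i)" "?edge (Dock, \<tau> i) (Port, \<sigma> i) (Dock, \<sigma> i)"
    using assms by auto
  then have "(?edge (Dock, \<tau> i))\<^sup>*\<^sup>* (Leaf, i) (Dock, \<sigma> i)"
    by (blast intro: converse_rtranclp_into_rtranclp)
  ultimately show ?thesis
    using assms by (simp add: asteroidal_triple_def)
qed

definition vertex :: "nat \<Rightarrow> role \<times> nat" where
  "vertex u = ([Hub, Rim, Port, Dock, Stem, Leaf] ! (u mod 6), u div 6)"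

lemma inj_vertex: "inj vertex"
proof (rule injI)
  fix u v assume "vertex u = vertex v"
  then have "u div 6 = v div 6" "u mod 6 = v mod 6"
    by (auto simp: vertex_def nth_eq_iff_index_eq)
  then show "u = v" by (metis div_mult_mod_eq)
qed

lemma vertex_image: "vertex ` {..<6 * m} = UNIV \<times> {..<m}"
proof
  show "vertex ` {..<6 * m} \<subseteq> UNIV \<times> {..<m}"
    by (auto simp: vertex_def)
  show "UNIV \<times> {..<m} \<subseteq> vertex ` {..<6 * m}"
  proof
    fix p :: "role \<times> nat" assume "p \<in> UNIV \<times> {..<m}"
    then obtain c i where p: "p = (c, i)" "i < m" by blast
    have "c \<in> set [Hub, Rim, Port, Dock, Stem, Leaf]"
      by (cases c) simp_all
    then obtain j where "j < 6" "[Hub, Rim, Port, Dock, Stem, Leaf] ! j = c"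
      unfolding in_set_conv_nth by (auto simp: eval_nat_numeral)
    with p have "vertex (6 * i + j) = p" "6 * i + j < 6 * m"
      by (auto simp: vertex_def)
    then show "p \<in> vertex ` {..<6 * m}" by blast
  qed
qed

definition gadget_graph :: "nat \<Rightarrow> nat \<Rightarrow> (nat \<Rightarrow> nat) \<Rightarrow> (nat \<Rightarrow> nat) \<Rightarrow> nat \<Rightarrow> nat \<Rightarrow> bool" where
  "gadget_graph m n \<sigma> \<tau> = add_universal (6 * m) n (\<lambda>u v. linked \<sigma> \<tau> (vertex u) (vertex v))"

lemma legal_config_gadget_graph:
  assumes "k \<ge> 1" "6 * m < n"
  shows "legal_config k n (gadget_graph m n \<sigma> \<tau>) Suc"
  unfolding gadget_graph_def
  by (intro legal_config_add_universal sympI assms) (rule sympD[OF symp_linked])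

lemma permutation_graph_gadget_graph:
  assumes "inj \<sigma>"
  shows "permutation_graph n (gadget_graph m n \<sigma> \<sigma>)"
proof -
  let ?x = "stacked \<sigma> top_rank \<circ> vertex" and ?y = "stacked \<sigma> bottom_rank \<circ> vertex"
  have "inj ?x" "inj ?y"
    using \<open>inj \<sigma>\<close>
    by (simp_all add: inj_compose inj_stacked inj_vertex inj_top_bottom_rank top_bottom_rank_less_6)
  then have "permutation_graph (6 * m) (\<lambda>u v. linked \<sigma> \<sigma> (vertex u) (vertex v))"
    by (intro permutation_graphI[of ?x _ ?y])
      (auto simp: linked_diagonal_iff_segments_cross[OF \<open>inj \<sigma>\<close>] segments_cross_def intro: inj_on_subset)
  then show ?thesis
    unfolding gadget_graph_def by (rule permutation_graph_add_universal)
qed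

lemma not_cocomparability_graph_gadget_graph:
  assumes "i < m" "\<sigma> i < m" "\<tau> i < m" "\<sigma> i \<noteq> \<tau> i" "6 * m \<le> n"
  shows "\<not> cocomparability_graph {..<n} (gadget_graph m n \<sigma> \<tau>)"
proof
  assume "cocomparability_graph {..<n} (gadget_graph m n \<sigma> \<tau>)"
  then have "cocomparability_graph {..<6 * m} (\<lambda>u v. linked \<sigma> \<tau> (vertex u) (vertex v))"
    by (rule cocomparability_graph_subset) (use assms(5) in \<open>auto simp: gadget_graph_def add_universal_def\<close>)
  then have "cocomparability_graph (vertex ` {..<6 * m}) (linked \<sigma> \<tau>)"
    by (rule cocomparability_graph_image) (rule inj_on_subset[OF inj_vertex subset_UNIV])
  then have "\<not> asteroidal_triple (UNIV \<times> {..<m}) (linked \<sigma> \<tau>) (Leaf, i) (Dock, \<sigma> i) (Dock, \<tau> i)"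
    unfolding vertex_image by (rule cocomparability_graph_imp_no_asteroidal_triple)
  moreover have "asteroidal_triple (UNIV \<times> {..<m}) (linked \<sigma> \<tau>) (Leaf, i) (Dock, \<sigma> i) (Dock, \<tau> i)"
    using assms(1-4) by (rule asteroidal_triple_linked)
  ultimately show False by blast
qed

lemma gadget_graph_eq_diagonal:
  "(\<forall>v. gadget_graph m n \<sigma> \<tau> u v \<longleftrightarrow> gadget_graph m n \<sigma> \<sigma> u v) \<or>
   (\<forall>v. gadget_graph m n \<sigma> \<tau> u v \<longleftrightarrow> gadget_graph m n \<tau> \<tau> u v)"
  unfolding gadget_graph_def add_universal_def
  using linked_eq_diagonal_left[of "vertex u"] linked_eq_diagonal_right[of "vertex u"] by blast

section \<open>Fooling sets for proof labeling schemes\<close>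

lemma card_bounded_bool_lists:
  "finite {c :: bool list. length c \<le> s}" "card {c :: bool list. length c \<le> s} \<le> 2 ^ (s + 1)"
proof -
  have eq: "{c :: bool list. length c \<le> s} = {c. set c \<subseteq> UNIV \<and> length c \<le> s}" by simp
  show "finite {c :: bool list. length c \<le> s}"
    unfolding eq by (rule finite_lists_length_le) simp
  have "card {c :: bool list. length c \<le> s} = (\<Sum>i\<le>s. 2 ^ i)"
    unfolding eq by (subst card_lists_length_le) auto
  also have "\<dots> \<le> 2 ^ (s + 1)"
    by (induction s) auto
  finally show "card {c :: bool list. length c \<le> s} \<le> 2 ^ (s + 1)" .
qed

lemma ex_pair_equal_certs:
  fixes cert :: "'i \<Rightarrow> nat \<Rightarrow> bool list"
  assumes short: "\<And>i u. i \<in> S \<Longrightarrow> u < n \<Longrightarrow> length (cert i u) \<le> s"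
    and large: "2 ^ ((s + 1) * n) < card S"
  obtains i j where "i \<in> S" "j \<in> S" "i \<noteq> j" "\<And>u. u < n \<Longrightarrow> cert i u = cert j u"
proof -
  let ?C = "{c :: bool list. length c \<le> s}"
  let ?r = "\<lambda>i. restrict (cert i) {..<n}"
  have "?r ` S \<subseteq> {..<n} \<rightarrow>\<^sub>E ?C"
    using short by (auto intro!: restrict_PiE_iff[THEN iffD2])
  then have "card (?r ` S) \<le> card ({..<n} \<rightarrow>\<^sub>E ?C)"
    by (intro card_mono finite_PiE card_bounded_bool_lists) auto
  also have "\<dots> = card ?C ^ n" by (simp add: card_PiE)
  also have "\<dots> \<le> (2 ^ (s + 1)) ^ n"
    by (intro power_mono card_bounded_bool_lists) auto
  also have "\<dots> < card S"
    using large by (simp only: power_mult)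
  finally have "\<not> inj_on ?r S" by (rule pigeonhole)
  then obtain i j where ij: "i \<in> S" "j \<in> S" "i \<noteq> j" and eq: "?r i = ?r j"
    unfolding inj_on_def by blast
  have "cert i u = cert j u" if "u < n" for u
    using fun_cong[OF eq, of u] that by simp
  with ij show ?thesis by (rule that)
qed

lemma local_view_cong:
  assumes "\<And>v. E u v \<longleftrightarrow> F u v" "\<And>v. v < n \<Longrightarrow> cert v = cert' v" "u < n"
  shows "local_view n E ident cert u = local_view n F ident cert' u"
  using assms unfolding local_view_def by auto

lemma pls_fooling_set:
  fixes E :: "'i \<Rightarrow> 'i \<Rightarrow> nat \<Rightarrow> nat \<Rightarrow> bool"
  assumes pls: "is_pls P k Ver s"
    and legal: "\<And>i j. i \<in> S \<Longrightarrow> j \<in> S \<Longrightarrow> legal_config k n (E i j) ident"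
    and yes: "\<And>i. i \<in> S \<Longrightarrow> P n (E i i)"
    and no: "\<And>i j. i \<in> S \<Longrightarrow> j \<in> S \<Longrightarrow> i \<noteq> j \<Longrightarrow> \<not> P n (E i j)"
    and cut: "\<And>i j u. i \<in> S \<Longrightarrow> j \<in> S \<Longrightarrow> u < n \<Longrightarrow>
      (\<forall>v. E i j u v \<longleftrightarrow> E i i u v) \<or> (\<forall>v. E i j u v \<longleftrightarrow> E j j u v)"
  shows "card S \<le> 2 ^ ((s n + 1) * n)"
proof (rule ccontr)
  assume "\<not> card S \<le> 2 ^ ((s n + 1) * n)"
  then have large: "2 ^ ((s n + 1) * n) < card S" by simp
  have "\<exists>cert. (\<forall>u<n. length (cert u) \<le> s n) \<and> (\<forall>u<n. Ver (local_view n (E i i) ident cert u))"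
    if "i \<in> S" for i
    using pls legal[OF that that] yes[OF that] unfolding is_pls_def by blast
  then obtain cert where short: "\<And>i u. i \<in> S \<Longrightarrow> u < n \<Longrightarrow> length (cert i u) \<le> s n"
    and accepted: "\<And>i u. i \<in> S \<Longrightarrow> u < n \<Longrightarrow> Ver (local_view n (E i i) ident (cert i) u)"
    by metis
  obtain i j where ij: "i \<in> S" "j \<in> S" "i \<noteq> j"
    and same: "\<And>u. u < n \<Longrightarrow> cert i u = cert j u"
    using ex_pair_equal_certs[of S n cert "s n", OF short large] by blast
  have "Ver (local_view n (E i j) ident (cert i) u)" if "u < n" for u
    using cut[OF ij(1,2) that]
  proof
    assume "\<forall>v. E i j u v \<longleftrightarrow> E i i u v"
    then have "local_view n (E i j) ident (cert i) u = local_view n (E i i) ident (cert i) u"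
      using that by (intro local_view_cong) auto
    then show ?thesis using accepted[OF ij(1) that] by simp
  next
    assume "\<forall>v. E i j u v \<longleftrightarrow> E j j u v"
    then have "local_view n (E i j) ident (cert i) u = local_view n (E j j) ident (cert j) u"
      using that same by (intro local_view_cong) auto
    then show ?thesis using accepted[OF ij(2) that] by simp
  qed
  then show False
    using pls legal[OF ij(1,2)] no[OF ij] unfolding is_pls_def by blast
qed

section \<open>The lower bound\<close>

lemma power_le_exp_mult_fact:
  fixes x :: real
  assumes "x \<ge> 0"
  shows "x ^ n \<le> exp x * fact n"
proof -
  have sums: "(\<lambda>i. x ^ i /\<^sub>R fact i) sums exp x"
    by (rule exp_converges)
  have "(\<Sum>i\<in>{n}. x ^ i /\<^sub>R fact i) \<le> (\<Sum>i. x ^ i /\<^sub>R fact i)"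
    using sums assms by (intro sum_le_suminf) (auto simp: sums_iff)
  then show ?thesis
    using sums by (simp add: sums_iff field_simps)
qed

lemma ln_fact_ge:
  assumes "n > 0"
  shows "real n * (ln (real n) - 1) \<le> ln (fact n)"
proof -
  have "ln (real n ^ n) \<le> ln (exp (real n) * fact n)"
    using assms by (intro ln_mono power_le_exp_mult_fact) auto
  then show ?thesis
    using assms by (simp add: ln_mult ln_realpow algebra_simps)
qed

lemma ln_le_if_fact_le_power2:
  assumes fact_le: "fact m \<le> (2 :: nat) ^ (t * n)" and "0 < n" "n \<le> b * m"
  shows "ln (real n) \<le> real b * real t + ln (real b) + 1"
proof -
  have "0 < b * m" using assms(2,3) by (rule less_le_trans)
  then have pos: "0 < m" "0 < b" by simp_all
  have "ln (real n) \<le> ln (real b * real m)"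
    using assms by (intro ln_mono) (simp_all flip: of_nat_mult)
  also have "\<dots> = ln (real b) + ln (real m)"
    using pos by (simp add: ln_mult)
  finally have ln_n: "ln (real n) \<le> ln (real b) + ln (real m)" .
  have "real (fact m) \<le> real (2 ^ (t * n))"
    using fact_le by (rule of_nat_mono)
  then have "ln (fact m) \<le> ln ((2 :: real) ^ (t * n))"
    by (intro ln_mono) auto
  also have "\<dots> = real (t * n) * ln 2" by (simp add: ln_realpow)
  also have "\<dots> \<le> real (t * n) * 1"
    using ln_2_less_1 by (intro mult_left_mono) auto
  finally have upper: "real m * (ln (real m) - 1) \<le> real t * real n"
    using ln_fact_ge[OF pos(1)] by simp
  have "ln (real m) - 1 \<le> real b * real t"
  proof (cases "ln (real m) \<ge> 1")
    case True
    have "(ln (real m) - 1) * real n \<le> (ln (real m) - 1) * (real b * real m)"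
      using True assms(3) by (intro mult_left_mono) (simp_all flip: of_nat_mult)
    also have "\<dots> \<le> real b * real t * real n"
      using mult_left_mono[OF upper, of "real b"] by (simp add: mult_ac)
    finally show ?thesis using \<open>0 < n\<close> by simp
  next
    case False
    moreover have "0 \<le> real b * real t" by simp
    ultimately show ?thesis by linarith
  qed
  with ln_n show ?thesis by linarith
qed

lemma bigomega_ln_if_fact_le_power2:
  fixes s :: "nat \<Rightarrow> nat"
  assumes "d > 0" and fact_le: "\<And>m n. d * m < n \<Longrightarrow> fact m \<le> (2 :: nat) ^ ((s n + 1) * n)"
  shows "(\<lambda>n. real (s n)) \<in> \<Omega>(\<lambda>n. ln (real n))"
proof (rule landau_omega.bigI)
  define b where "b = 2 * d"
  define C where "C = real b + ln (real b) + 1"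
  show "1 / (2 * real b) > 0" using \<open>d > 0\<close> by (simp add: b_def)
  have "filterlim (\<lambda>n. ln (real n)) at_top sequentially"
    by (intro filterlim_compose[OF ln_at_top] filterlim_real_sequentially)
  then have "\<forall>\<^sub>F n in sequentially. ln (real n) \<ge> 2 * C"
    by (simp add: filterlim_at_top)
  then show "\<forall>\<^sub>F n in sequentially. norm (real (s n)) \<ge> 1 / (2 * real b) * norm (ln (real n))"
    using eventually_gt_at_top[of d]
  proof eventually_elim
    case (elim n)
    define m where "m = (n - 1) div d"
    have "d * m + (n - 1) mod d = n - 1" "(n - 1) mod d < d"
      using \<open>d > 0\<close> by (simp_all add: m_def)
    moreover have "d * 1 \<le> d * m"
      using elim(2) \<open>d > 0\<close> by (intro mult_le_mono2) (simp add: m_def Suc_le_eq div_greater_zero_iff)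
    ultimately have "d * m < n" "n \<le> b * m"
      using elim(2) unfolding b_def by linarith+
    then have "ln (real n) \<le> real b * real (s n + 1) + ln (real b) + 1"
      using elim(2) by (intro ln_le_if_fact_le_power2[OF fact_le]) auto
    then have "ln (real n) \<le> 2 * real b * real (s n)"
      using elim(1) by (simp add: C_def algebra_simps)
    then show ?case
      using \<open>d > 0\<close> elim(2) by (simp add: b_def field_simps)
  qed
qed

lemma pls_size_bigomega_ln:
  assumes pls: "is_pls P k Ver s" and "k \<ge> 1"
    and yes: "\<And>n E. permutation_graph n E \<Longrightarrow> P n E"
    and no: "\<And>n E. P n E \<Longrightarrow> cocomparability_graph {..<n} E"
  shows "(\<lambda>n. real (s n)) \<in> \<Omega>(\<lambda>n. ln (real n))"
proof (rule bigomega_ln_if_fact_le_power2[of 6])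
  fix m n :: nat assume n: "6 * m < n"
  let ?S = "{\<sigma>. \<sigma> permutes {..<m}}"
  have "card ?S \<le> 2 ^ ((s n + 1) * n)"
  proof (rule pls_fooling_set[OF pls, where E = "gadget_graph m n" and ident = Suc])
    show "legal_config k n (gadget_graph m n \<sigma> \<tau>) Suc" for \<sigma> \<tau>
      using \<open>k \<ge> 1\<close> n by (rule legal_config_gadget_graph)
    show "P n (gadget_graph m n \<sigma> \<sigma>)" if "\<sigma> \<in> ?S" for \<sigma>
      using that by (intro yes permutation_graph_gadget_graph) (auto dest: permutes_inj)
    show "\<not> P n (gadget_graph m n \<sigma> \<tau>)"
      if perm: "\<sigma> \<in> ?S" "\<tau> \<in> ?S" and "\<sigma> \<noteq> \<tau>" for \<sigma> \<tau>
    proof -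
      obtain i where i: "\<sigma> i \<noteq> \<tau> i" using \<open>\<sigma> \<noteq> \<tau>\<close> by blast
      then have "i < m" using perm by (metis lessThan_iff mem_Collect_eq permutes_not_in)
      moreover from this have "\<sigma> i < m" "\<tau> i < m"
        using perm permutes_in_image[of _ "{..<m}" i] by auto
      ultimately show ?thesis
        using no not_cocomparability_graph_gadget_graph i n by (metis less_imp_le)
    qed
  qed (rule gadget_graph_eq_diagonal)
  then show "fact m \<le> (2 :: nat) ^ ((s n + 1) * n)"
    by (simp add: card_permutations[OF card_lessThan])
qed simp

theorem theorem5:
  fixes k :: nat
  assumes "k \<ge> 1"
  shows "(\<forall>Ver s. is_pls permutation_graph k Ver s \<longrightarrow>
            (\<lambda>n. real (s n)) \<in> \<Omega>(\<lambda>n. ln (real n))) \<and>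
         (\<forall>Ver s. is_pls trapezoid_graph k Ver s \<longrightarrow>
            (\<lambda>n. real (s n)) \<in> \<Omega>(\<lambda>n. ln (real n)))"
proof (intro conjI allI impI)
  fix Ver s
  show "(\<lambda>n. real (s n)) \<in> \<Omega>(\<lambda>n. ln (real n))" if "is_pls permutation_graph k Ver s"
    using that assms
    by (rule pls_size_bigomega_ln)
      (auto intro: permutation_graph_imp_trapezoid_graph trapezoid_graph_imp_cocomparability_graph)
  show "(\<lambda>n. real (s n)) \<in> \<Omega>(\<lambda>n. ln (real n))" if "is_pls trapezoid_graph k Ver s"
    using that assms permutation_graph_imp_trapezoid_graph trapezoid_graph_imp_cocomparability_graph
    by (rule pls_size_bigomega_ln)
qed

end
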